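(* Let $R$ be a commutative ring with unity. The following conditions are equivalent: (1) For each $R$-algebra $S$ and for each left $S$-module $M$ for which $\mathrm{End}_S(M)$ is local, there exists only one minimal prime ideal $A$ of $R$ such that $\mathrm{Supp}\,M\subseteq V(A)$ (i.e. exactly one such $A$ exists). (2) Every prime ideal of $R$ contains only one minimal prime ideal.
   Context: $V(A)=\{P\in\mathrm{Spec}\,R\mid A\subseteq P\}$. $R$-algebras are associative and unital but not necessarily commutative. For a left $S$-module $M$, viewed as an $R$-module, $\mathrm{Supp}\,M=\{P\in\mathrm{Spec}\,R\mid M_P\neq 0\}$. A (possibly noncommutative) ring is local if it is nonzero and its non-units form a two-sided ideal. *)

theory Defs
  imports "HOL-Algebra.Ideal" "HOL-Algebra.Module"
begin

section \<open>Prime spectrum\<close>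

definition Spec :: "('a, 'b) ring_scheme \<Rightarrow> 'a set set" where
  "Spec R = {P. primeideal P R}"

definition V :: "('a, 'b) ring_scheme \<Rightarrow> 'a set \<Rightarrow> 'a set set" where
  "V R A = {P \<in> Spec R. A \<subseteq> P}"

definition minimal_prime :: "('a, 'b) ring_scheme \<Rightarrow> 'a set \<Rightarrow> bool" where
  "minimal_prime R A \<longleftrightarrow> A \<in> Spec R \<and> (\<forall>B \<in> Spec R. B \<subseteq> A \<longrightarrow> B = A)"


section \<open>Noncommutative algebras and left modules\<close>

text \<open>The locales \<^locale>\<open>algebra\<close> and \<^locale>\<open>module\<close> of the library require a commutative
  algebra and a commutative ring of scalars, respectively.\<close>

locale assoc_algebra = module R S + ring S
  for R :: "('a, 'b) ring_scheme" (structure) and S :: "('a, 's, 'c) module_scheme" (structure) +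
  assumes smult_mult_left:
      "\<lbrakk> a \<in> carrier R; x \<in> carrier S; y \<in> carrier S \<rbrakk> \<Longrightarrow>
        (a \<odot>\<^bsub>S\<^esub> x) \<otimes>\<^bsub>S\<^esub> y = a \<odot>\<^bsub>S\<^esub> (x \<otimes>\<^bsub>S\<^esub> y)"
    and smult_mult_right:
      "\<lbrakk> a \<in> carrier R; x \<in> carrier S; y \<in> carrier S \<rbrakk> \<Longrightarrow>
        x \<otimes>\<^bsub>S\<^esub> (a \<odot>\<^bsub>S\<^esub> y) = a \<odot>\<^bsub>S\<^esub> (x \<otimes>\<^bsub>S\<^esub> y)"

locale left_module = S?: ring S + M?: abelian_group M
  for S :: "('s, 'b) ring_scheme" (structure) and M :: "('s, 'm, 'c) module_scheme" (structure) +
  assumes lsmult_closed: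
      "\<lbrakk> a \<in> carrier S; x \<in> carrier M \<rbrakk> \<Longrightarrow> a \<odot>\<^bsub>M\<^esub> x \<in> carrier M"
    and lsmult_l_distr:
      "\<lbrakk> a \<in> carrier S; b \<in> carrier S; x \<in> carrier M \<rbrakk> \<Longrightarrow>
        (a \<oplus>\<^bsub>S\<^esub> b) \<odot>\<^bsub>M\<^esub> x = a \<odot>\<^bsub>M\<^esub> x \<oplus>\<^bsub>M\<^esub> b \<odot>\<^bsub>M\<^esub> x"
    and lsmult_r_distr:
      "\<lbrakk> a \<in> carrier S; x \<in> carrier M; y \<in> carrier M \<rbrakk> \<Longrightarrow>
        a \<odot>\<^bsub>M\<^esub> (x \<oplus>\<^bsub>M\<^esub> y) = a \<odot>\<^bsub>M\<^esub> x \<oplus>\<^bsub>M\<^esub> a \<odot>\<^bsub>M\<^esub> y"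
    and lsmult_assoc:
      "\<lbrakk> a \<in> carrier S; b \<in> carrier S; x \<in> carrier M \<rbrakk> \<Longrightarrow>
        (a \<otimes>\<^bsub>S\<^esub> b) \<odot>\<^bsub>M\<^esub> x = a \<odot>\<^bsub>M\<^esub> (b \<odot>\<^bsub>M\<^esub> x)"
    and lsmult_one:
      "x \<in> carrier M \<Longrightarrow> \<one>\<^bsub>S\<^esub> \<odot>\<^bsub>M\<^esub> x = x"

text \<open>Restriction of scalars along the structure map \<open>r \<mapsto> r \<cdot> 1\<close> from \<open>R\<close> to the
  \<open>R\<close>-algebra \<open>S\<close>. As in every module record here, the fields \<open>mult\<close> and \<open>one\<close> carry no meaning.\<close>

definition restrict_scalars ::
    "('r, 's, 'c) module_scheme \<Rightarrow> ('s, 'm, 'd) module_scheme \<Rightarrow> ('r, 'm) module" where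
  "restrict_scalars S M =
     \<lparr> carrier = carrier M, mult = mult M, one = \<one>\<^bsub>M\<^esub>,
       zero = \<zero>\<^bsub>M\<^esub>, add = add M,
       smult = (\<lambda>r x. (r \<odot>\<^bsub>S\<^esub> \<one>\<^bsub>S\<^esub>) \<odot>\<^bsub>M\<^esub> x) \<rparr>"


section \<open>Endomorphism rings and local rings\<close>

text \<open>Endomorphisms are extensional functions, so that equality in the carrier is equality of maps.\<close>

definition module_End ::
    "('s, 'b) ring_scheme \<Rightarrow> ('s, 'm, 'c) module_scheme \<Rightarrow> ('m \<Rightarrow> 'm) ring" where
  "module_End S M =
     \<lparr> carrier = {f \<in> carrier M \<rightarrow>\<^sub>E carrier M.
         (\<forall>x \<in> carrier M. \<forall>y \<in> carrier M. f (x \<oplus>\<^bsub>M\<^esub> y) = f x \<oplus>\<^bsub>M\<^esub> f y) \<and>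
         (\<forall>a \<in> carrier S. \<forall>x \<in> carrier M. f (a \<odot>\<^bsub>M\<^esub> x) = a \<odot>\<^bsub>M\<^esub> f x)},
       mult = (\<lambda>f g. \<lambda>x \<in> carrier M. f (g x)),
       one = (\<lambda>x \<in> carrier M. x),
       zero = (\<lambda>x \<in> carrier M. \<zero>\<^bsub>M\<^esub>),
       add = (\<lambda>f g. \<lambda>x \<in> carrier M. f x \<oplus>\<^bsub>M\<^esub> g x) \<rparr>"

definition local_ring :: "('a, 'b) ring_scheme \<Rightarrow> bool" where
  "local_ring E \<longleftrightarrow>
     ring E \<and> carrier E \<noteq> {\<zero>\<^bsub>E\<^esub>} \<and> ideal (carrier E - Units E) E"


section \<open>Localization of modules at a prime, and support\<close>

definition frac_rel ::
    "('r, 'b) ring_scheme \<Rightarrow> ('r, 'm, 'c) module_scheme \<Rightarrow> 'r set \<Rightarrow> (('m \<times> 'r) \<times> ('m \<times> 'r)) set"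
  where
  "frac_rel R M P =
     {((x, s), (y, t)). x \<in> carrier M \<and> y \<in> carrier M \<and>
        s \<in> carrier R - P \<and> t \<in> carrier R - P \<and>
        (\<exists>u \<in> carrier R - P. u \<odot>\<^bsub>M\<^esub> (t \<odot>\<^bsub>M\<^esub> x) = u \<odot>\<^bsub>M\<^esub> (s \<odot>\<^bsub>M\<^esub> y))}"

text \<open>For an ideal \<open>P\<close> that is prime, the class of \<open>(x, s)\<close> is the fraction \<open>x / s\<close>.\<close>

definition fraction ::
    "('r, 'b) ring_scheme \<Rightarrow> ('r, 'm, 'c) module_scheme \<Rightarrow> 'r set \<Rightarrow> 'm \<Rightarrow> 'r \<Rightarrow> ('m \<times> 'r) set"
  where
  "fraction R M P x s = frac_rel R M P `` {(x, s)}"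

definition localized_module ::
    "('r, 'b) ring_scheme \<Rightarrow> ('r, 'm, 'c) module_scheme \<Rightarrow> 'r set \<Rightarrow> ('r, ('m \<times> 'r) set) module"
  where
  "localized_module R M P =
     \<lparr> carrier = (carrier M \<times> (carrier R - P)) // frac_rel R M P,
       mult = undefined, one = undefined,
       zero = fraction R M P \<zero>\<^bsub>M\<^esub> \<one>\<^bsub>R\<^esub>,
       add = (\<lambda>F G. \<Union>(x, s) \<in> F. \<Union>(y, t) \<in> G.
                fraction R M P (t \<odot>\<^bsub>M\<^esub> x \<oplus>\<^bsub>M\<^esub> s \<odot>\<^bsub>M\<^esub> y) (s \<otimes>\<^bsub>R\<^esub> t)),
       smult = (\<lambda>r F. \<Union>(x, s) \<in> F. fraction R M P (r \<odot>\<^bsub>M\<^esub> x) s) \<rparr>"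

definition Supp :: "('r, 'b) ring_scheme \<Rightarrow> ('r, 'm, 'c) module_scheme \<Rightarrow> 'r set set" where
  "Supp R M = {P \<in> Spec R.
     carrier (localized_module R M P) \<noteq> {\<zero>\<^bsub>localized_module R M P\<^esub>}}"

text \<open>A formula cannot quantify over types, so \<open>for all S and M\<close> ranges over structures on fixed
  types. For a ring \<open>R\<close> on \<open>'a\<close>, the types \<open>'a\<close> for \<open>S\<close> and \<open>('a \<times> 'a) set\<close> for \<open>M\<close> are large
  enough to hold \<open>R\<close> itself and its localizations at primes. The equivalence is therefore stated
  over these types, and the implication from the condition on \<open>R\<close> to the condition on modules in
  addition over arbitrary types \<open>'s\<close> and \<open>'m\<close>. Together the two parts say that the condition on \<open>R\<close>
  is equivalent to the condition on modules imposed over all types.\<close>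

end

theory Submission
  imports Defs "HOL-Algebra.QuotRing" "HOL-Algebra.Ring_Divisibility"
begin

text \<open>
  Suppose every prime contains only one minimal prime, and let \<open>M\<close> have a local endomorphism ring.
  The elements of \<open>R\<close> that act on \<open>M\<close> as non-units of \<open>End\<^sub>S(M)\<close> form a prime ideal \<open>Q\<close>, which lies in
  \<open>Supp M\<close>. If \<open>P \<in> Supp M\<close>, then \<open>p q \<noteq> 0\<close> for all \<open>p \<notin> P\<close>, \<open>q \<notin> Q\<close>, since \<open>q\<close> acts bijectively
  and \<open>M\<^sub>P \<noteq> 0\<close>; so some prime avoids all these products and lies in \<open>P \<inter> Q\<close>, and the minimal prime
  below it is the one below \<open>Q\<close>. Conversely, the \<open>R\<close>-module \<open>R\<^sub>P\<close> has the local endomorphism ring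
  \<open>R\<^sub>P\<close>, and its support contains every prime below \<open>P\<close>.
\<close>

section \<open>Prime ideals avoiding a multiplicative set\<close>

text \<open>An ideal \<open>P\<close> maximal among those disjoint from \<open>T\<close> is prime:
  for \<open>a\<close>, \<open>b\<close> outside \<open>P\<close>, both \<open>P + (a)\<close> and
  \<open>P + (b)\<close> meet \<open>T\<close>, and the product of the two common elements is in
  \<open>T\<close> and congruent modulo \<open>P\<close> to a multiple of \<open>ab\<close>.\<close>

lemma (in cring) exists_primeideal_disjoint:
  assumes T: "T \<subseteq> carrier R" "\<one> \<in> T" "\<zero> \<notin> T"
    and mult: "\<And>s t. s \<in> T \<Longrightarrow> t \<in> T \<Longrightarrow> s \<otimes> t \<in> T"
  obtains P where "primeideal P R" "P \<inter> T = {}"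
proof -
  let ?D = "{I. ideal I R \<and> I \<inter> T = {}}"
  have "\<exists>P\<in>?D. \<forall>J\<in>?D. P \<subseteq> J \<longrightarrow> J = P"
  proof (rule subset_Zorn_nonempty)
    show "?D \<noteq> {}"
      using zeroideal T by blast
  next
    fix C assume C: "C \<noteq> {}" "subset.chain ?D C"
    then have "subset.chain {I. ideal I R} C"
      unfolding subset_chain_def by blast
    from chain_Union_is_ideal[OF this] C show "\<Union>C \<in> ?D"
      unfolding subset_chain_def by auto
  qed
  then obtain P where P: "ideal P R" "P \<inter> T = {}"
    and max: "\<And>J. ideal J R \<Longrightarrow> J \<inter> T = {} \<Longrightarrow> P \<subseteq> J \<Longrightarrow> J = P"
    by auto
  interpret P: ideal P R by (fact P(1))
  \<comment> \<open>The ideal \<open>P + (a)\<close> is strictly larger than \<open>P\<close>, so by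
    maximality it cannot miss \<open>T\<close>.\<close>
  have meets: "\<exists>p\<in>P. \<exists>r\<in>carrier R. p \<oplus> r \<otimes> a \<in> T" if a: "a \<in> carrier R" "a \<notin> P" for a
  proof -
    let ?J = "P <+>\<^bsub>R\<^esub> PIdl a"
    have J: "ideal ?J R"
      by (intro add_ideals P cgenideal_ideal a)
    have z: "\<zero> \<in> PIdl a"
      using cgenideal_ideal[OF a(1)] by (simp add: additive_subgroup.zero_closed ideal.axioms(1))
    have "P \<subseteq> ?J"
      using z P.a_subset unfolding set_add_def' by force
    moreover have "a \<in> ?J"
    proof -
      have "a = \<zero> \<oplus> a" using a by simp
      then show ?thesis
        using cgenideal_self[OF a(1)] P.zero_closed unfolding set_add_def' by blast
    qed
    ultimately have "?J \<inter> T \<noteq> {}"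
      using max[OF J] a(2) by blast
    then show ?thesis
      unfolding set_add_def' cgenideal_def by blast
  qed
  have "primeideal P R"
  proof (rule primeidealI[OF P(1) is_cring])
    show "carrier R \<noteq> P"
      using T P(2) by blast
  next
    fix a b assume ab: "a \<in> carrier R" "b \<in> carrier R" "a \<otimes> b \<in> P"
    show "a \<in> P \<or> b \<in> P"
    proof (rule ccontr)
      assume "\<not> (a \<in> P \<or> b \<in> P)"
      then obtain p r q s where *: "p \<in> P" "r \<in> carrier R" "p \<oplus> r \<otimes> a \<in> T"
        "q \<in> P" "s \<in> carrier R" "q \<oplus> s \<otimes> b \<in> T"
        using meets ab by meson
      \<comment> \<open>After expansion every summand has a factor in \<open>P\<close>, namely
        \<open>p\<close>, \<open>q\<close> or \<open>a \<otimes> b\<close>.\<close>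
      have "(p \<oplus> r \<otimes> a) \<otimes> (q \<oplus> s \<otimes> b) =
          p \<otimes> (q \<oplus> s \<otimes> b) \<oplus> (r \<otimes> a) \<otimes> q \<oplus> (r \<otimes> s) \<otimes> (a \<otimes> b)"
        using * ab P.Icarr by algebra
      also have "\<dots> \<in> P"
        using * T(1) ab by (intro P.a_closed P.I_r_closed[of p] P.I_l_closed[of q] P.I_l_closed[of "a \<otimes> b"]) auto
      finally show False
        using mult[OF *(3,6)] P(2) by blast
    qed
  qed
  with P(2) that show thesis by blast
qed

section \<open>A criterion for local rings\<close>

text \<open>A proper ideal contains no unit, so \<open>K\<close> is forced to be exactly the set of
  non-units. This allows the non-units to be described by a condition that is visibly closed under
  the ideal operations.\<close>

lemma local_ringI:
  assumes "ring E" "ideal K E" "\<one>\<^bsub>E\<^esub> \<notin> K" "carrier E - K \<subseteq> Units E"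
  shows "local_ring E"
proof -
  interpret ring E by fact
  interpret K: ideal K E by fact
  have "k \<notin> Units E" if "k \<in> K" for k
    using that K.I_r_closed[OF that, of "inv\<^bsub>E\<^esub> k"] assms(3) by auto
  then have "carrier E - Units E = K"
    using assms(4) K.a_subset by blast
  \<comment> \<open>The ring is nonzero because \<open>K\<close> contains zero but not one.\<close>
  then show ?thesis
    unfolding local_ring_def using assms(1-3) K.zero_closed one_closed by (metis singletonD)
qed

section \<open>The endomorphism ring of a left module\<close>

context left_module
begin

abbreviation "E \<equiv> module_End S M"

lemma End_closed: "f \<in> carrier E \<Longrightarrow> x \<in> carrier M \<Longrightarrow> f x \<in> carrier M"
  by (auto simp: module_End_def)

lemma End_add:
  "f \<in> carrier E \<Longrightarrow> x \<in> carrier M \<Longrightarrow> y \<in> carrier M \<Longrightarrow> f (x \<oplus>\<^bsub>M\<^esub> y) = f x \<oplus>\<^bsub>M\<^esub> f y"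
  by (auto simp: module_End_def)

lemma End_smult:
  "f \<in> carrier E \<Longrightarrow> a \<in> carrier S \<Longrightarrow> x \<in> carrier M \<Longrightarrow> f (a \<odot>\<^bsub>M\<^esub> x) = a \<odot>\<^bsub>M\<^esub> f x"
  by (auto simp: module_End_def)

lemma End_ext:
  "f \<in> carrier E \<Longrightarrow> g \<in> carrier E \<Longrightarrow> (\<And>x. x \<in> carrier M \<Longrightarrow> f x = g x) \<Longrightarrow> f = g"
  unfolding module_End_def by (auto intro: PiE_ext)

lemma End_memI:
  assumes "\<And>x. x \<in> carrier M \<Longrightarrow> f x \<in> carrier M"
    and "\<And>x y. x \<in> carrier M \<Longrightarrow> y \<in> carrier M \<Longrightarrow> f (x \<oplus>\<^bsub>M\<^esub> y) = f x \<oplus>\<^bsub>M\<^esub> f y"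
    and "\<And>a x. a \<in> carrier S \<Longrightarrow> x \<in> carrier M \<Longrightarrow> f (a \<odot>\<^bsub>M\<^esub> x) = a \<odot>\<^bsub>M\<^esub> f x"
  shows "restrict f (carrier M) \<in> carrier E"
  using assms by (simp add: module_End_def lsmult_closed)

lemma End_apply:
  "x \<in> carrier M \<Longrightarrow> (f \<oplus>\<^bsub>E\<^esub> g) x = f x \<oplus>\<^bsub>M\<^esub> g x"
  "x \<in> carrier M \<Longrightarrow> (f \<otimes>\<^bsub>E\<^esub> g) x = f (g x)"
  "x \<in> carrier M \<Longrightarrow> \<one>\<^bsub>E\<^esub> x = x"
  "x \<in> carrier M \<Longrightarrow> \<zero>\<^bsub>E\<^esub> x = \<zero>\<^bsub>M\<^esub>"
  by (simp_all add: module_End_def)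

lemma lsmult_r_null: "a \<in> carrier S \<Longrightarrow> a \<odot>\<^bsub>M\<^esub> \<zero>\<^bsub>M\<^esub> = \<zero>\<^bsub>M\<^esub>"
  by (metis M.add.r_cancel_one' M.l_zero M.zero_closed lsmult_closed lsmult_r_distr)

lemma lsmult_r_minus:
  "a \<in> carrier S \<Longrightarrow> x \<in> carrier M \<Longrightarrow> a \<odot>\<^bsub>M\<^esub> (\<ominus>\<^bsub>M\<^esub> x) = \<ominus>\<^bsub>M\<^esub> (a \<odot>\<^bsub>M\<^esub> x)"
  by (metis M.a_inv_closed M.l_neg M.minus_equality lsmult_closed lsmult_r_distr lsmult_r_null)

lemma End_add_closed:
  assumes f: "f \<in> carrier E" and g: "g \<in> carrier E"
  shows "f \<oplus>\<^bsub>E\<^esub> g \<in> carrier E"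
proof -
  have "(\<lambda>x\<in>carrier M. f x \<oplus>\<^bsub>M\<^esub> g x) \<in> carrier E"
    by (rule End_memI)
      (simp_all add: f g End_closed[OF f] End_closed[OF g] End_add End_smult M.a_ac lsmult_r_distr)
  then show ?thesis
    by (simp add: module_End_def)
qed

lemma End_mult_closed:
  assumes f: "f \<in> carrier E" and g: "g \<in> carrier E"
  shows "f \<otimes>\<^bsub>E\<^esub> g \<in> carrier E"
proof -
  have "(\<lambda>x\<in>carrier M. f (g x)) \<in> carrier E"
    by (rule End_memI)
      (simp_all add: f g End_closed[OF f] End_closed[OF g] End_add End_smult)
  then show ?thesis
    by (simp add: module_End_def)
qed

lemma End_one_closed: "\<one>\<^bsub>E\<^esub> \<in> carrier E"
  using End_memI[of "\<lambda>x. x"] by (simp add: module_End_def)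

lemma End_zero_closed: "\<zero>\<^bsub>E\<^esub> \<in> carrier E"
  using End_memI[of "\<lambda>x. \<zero>\<^bsub>M\<^esub>"] by (simp add: module_End_def lsmult_r_null)

lemma End_minus_closed:
  "f \<in> carrier E \<Longrightarrow> (\<lambda>x\<in>carrier M. \<ominus>\<^bsub>M\<^esub> f x) \<in> carrier E"
  by (rule End_memI) (simp_all add: End_closed End_add End_smult M.minus_add lsmult_r_minus)

text \<open>\<open>End_ext\<close> reduces each ring law to a pointwise identity in
  \<open>M\<close>.\<close>

lemma ring_End: "ring E"
proof (rule ringI)
  show "abelian_group E"
  proof (rule abelian_groupI)
    fix f g h assume fgh: "f \<in> carrier E" "g \<in> carrier E" "h \<in> carrier E"
    show "(f \<oplus>\<^bsub>E\<^esub> g) \<oplus>\<^bsub>E\<^esub> h = f \<oplus>\<^bsub>E\<^esub> (g \<oplus>\<^bsub>E\<^esub> h)"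
      using fgh by (intro End_ext End_add_closed) (simp_all add: End_apply End_closed M.a_assoc)
  next
    fix f g assume fg: "f \<in> carrier E" "g \<in> carrier E"
    show "f \<oplus>\<^bsub>E\<^esub> g = g \<oplus>\<^bsub>E\<^esub> f"
      using fg by (intro End_ext End_add_closed) (simp_all add: End_apply End_closed M.a_comm)
  next
    fix f assume f: "f \<in> carrier E"
    show "\<zero>\<^bsub>E\<^esub> \<oplus>\<^bsub>E\<^esub> f = f"
      using f by (intro End_ext End_add_closed End_zero_closed) (simp_all add: End_apply End_closed)
    show "\<exists>g\<in>carrier E. g \<oplus>\<^bsub>E\<^esub> f = \<zero>\<^bsub>E\<^esub>"
      using End_minus_closed[OF f] f
      by (intro bexI[of _ "\<lambda>x\<in>carrier M. \<ominus>\<^bsub>M\<^esub> f x"] End_ext)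
        (simp_all add: End_add_closed End_zero_closed End_apply End_closed M.l_neg)
  qed (simp_all add: End_add_closed End_zero_closed)
  show "monoid E"
  proof (rule monoidI)
    fix f g h assume fgh: "f \<in> carrier E" "g \<in> carrier E" "h \<in> carrier E"
    show "(f \<otimes>\<^bsub>E\<^esub> g) \<otimes>\<^bsub>E\<^esub> h = f \<otimes>\<^bsub>E\<^esub> (g \<otimes>\<^bsub>E\<^esub> h)"
      using fgh by (intro End_ext End_mult_closed) (simp_all add: End_apply End_closed)
  next
    fix f assume f: "f \<in> carrier E"
    show "\<one>\<^bsub>E\<^esub> \<otimes>\<^bsub>E\<^esub> f = f" "f \<otimes>\<^bsub>E\<^esub> \<one>\<^bsub>E\<^esub> = f"
      using f by (intro End_ext End_mult_closed End_one_closed; simp add: End_apply End_closed)+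
  qed (simp_all add: End_mult_closed End_one_closed)
next
  fix f g h assume fgh: "f \<in> carrier E" "g \<in> carrier E" "h \<in> carrier E"
  show "(f \<oplus>\<^bsub>E\<^esub> g) \<otimes>\<^bsub>E\<^esub> h = f \<otimes>\<^bsub>E\<^esub> h \<oplus>\<^bsub>E\<^esub> g \<otimes>\<^bsub>E\<^esub> h"
    using fgh by (intro End_ext End_add_closed End_mult_closed) (simp_all add: End_apply End_closed)
  show "h \<otimes>\<^bsub>E\<^esub> (f \<oplus>\<^bsub>E\<^esub> g) = h \<otimes>\<^bsub>E\<^esub> f \<oplus>\<^bsub>E\<^esub> h \<otimes>\<^bsub>E\<^esub> g"
    using fgh by (intro End_ext End_add_closed End_mult_closed)
      (simp_all add: End_apply End_closed End_add)
qed

text \<open>The additive inverse in \<open>E\<close> comes from the group structure and not from a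
  formula; uniqueness of inverses identifies it with the pointwise negative.\<close>

lemma End_a_inv_apply:
  assumes f: "f \<in> carrier E" and x: "x \<in> carrier M"
  shows "(\<ominus>\<^bsub>E\<^esub> f) x = \<ominus>\<^bsub>M\<^esub> f x"
proof -
  interpret E: ring E by (rule ring_End)
  have "\<ominus>\<^bsub>E\<^esub> f = (\<lambda>x\<in>carrier M. \<ominus>\<^bsub>M\<^esub> f x)"
    using f End_minus_closed[OF f]
    by (intro E.minus_equality End_ext)
      (simp_all add: End_add_closed End_zero_closed End_apply End_closed M.l_neg)
  then show ?thesis using x by simp
qed

text \<open>The set-theoretic inverse of a bijective linear map is linear, so invertibility in
  \<open>E\<close> can be settled by looking at kernels and images.\<close>

lemma End_Units_iff: "f \<in> Units E \<longleftrightarrow> f \<in> carrier E \<and> bij_betw f (carrier M) (carrier M)"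
proof
  interpret E: ring E by (rule ring_End)
  assume f: "f \<in> Units E"
  then obtain g where g: "g \<in> carrier E" "g \<otimes>\<^bsub>E\<^esub> f = \<one>\<^bsub>E\<^esub>" "f \<otimes>\<^bsub>E\<^esub> g = \<one>\<^bsub>E\<^esub>"
    unfolding Units_def by blast
  then have "g (f x) = x" "f (g x) = x" if "x \<in> carrier M" for x
    using End_apply(2,3) that by metis+
  then have "bij_betw f (carrier M) (carrier M)"
    using f g(1) E.Units_closed[OF f]
    by (intro bij_betw_byWitness[where f' = g]) (simp_all add: image_subset_iff End_closed)
  with f show "f \<in> carrier E \<and> bij_betw f (carrier M) (carrier M)"
    by blast
next
  assume f: "f \<in> carrier E \<and> bij_betw f (carrier M) (carrier M)"
  \<comment> \<open>\<open>?h\<close> is convenient for computing, while its restriction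
    \<open>?g\<close> is extensional, as members of \<open>E\<close> have to be.\<close>
  let ?h = "inv_into (carrier M) f" and ?g = "restrict (inv_into (carrier M) f) (carrier M)"
  have h: "?h x \<in> carrier M" "f (?h x) = x" "?h (f x) = x" if "x \<in> carrier M" for x
    using f that by (auto simp: bij_betw_def inv_into_into f_inv_into_f)
  \<comment> \<open>Linearity of the inverse is checked by applying \<open>f\<close> to the expected
    value.\<close>
  have h_eq: "?h y = x" if "f x = y" "x \<in> carrier M" for x y
    using that h(3) by blast
  have "?g \<in> carrier E"
  proof (rule End_memI)
    fix x y assume "x \<in> carrier M" "y \<in> carrier M"
    with f h show "?h (x \<oplus>\<^bsub>M\<^esub> y) = ?h x \<oplus>\<^bsub>M\<^esub> ?h y"
      by (intro h_eq) (simp_all add: End_add)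
  next
    fix a x assume "a \<in> carrier S" "x \<in> carrier M"
    with f h show "?h (a \<odot>\<^bsub>M\<^esub> x) = a \<odot>\<^bsub>M\<^esub> ?h x"
      by (intro h_eq) (simp_all add: End_smult lsmult_closed)
  qed (rule h(1))
  moreover have "?g \<otimes>\<^bsub>E\<^esub> f = \<one>\<^bsub>E\<^esub>" "f \<otimes>\<^bsub>E\<^esub> ?g = \<one>\<^bsub>E\<^esub>"
    using f h calculation
    by (intro End_ext End_mult_closed End_one_closed; simp add: End_apply End_closed)+
  ultimately show "f \<in> Units E"
    using f unfolding Units_def by blast
qed

end

section \<open>The action of R on a module over an R-algebra\<close>

context
  fixes R :: "('r, 'b) ring_scheme" and S :: "('r, 's, 'c) module_scheme" and M :: "('s, 'm, 'd) module_scheme"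
  assumes alg: "assoc_algebra R S" and lmod: "left_module S M"
begin

interpretation A: assoc_algebra R S by (fact alg)
interpretation L: left_module S M by (fact lmod)

lemma scalar_closed: "r \<in> carrier R \<Longrightarrow> r \<odot>\<^bsub>S\<^esub> \<one>\<^bsub>S\<^esub> \<in> carrier S"
  by simp

lemma scalar_mult:
  assumes "r \<in> carrier R" "r' \<in> carrier R"
  shows "(r \<otimes>\<^bsub>R\<^esub> r') \<odot>\<^bsub>S\<^esub> \<one>\<^bsub>S\<^esub> = (r \<odot>\<^bsub>S\<^esub> \<one>\<^bsub>S\<^esub>) \<otimes>\<^bsub>S\<^esub> (r' \<odot>\<^bsub>S\<^esub> \<one>\<^bsub>S\<^esub>)"
  using assms by (simp add: A.smult_mult_left A.smult_assoc1)

text \<open>The image of \<open>R\<close> in \<open>S\<close> is central, although \<open>S\<close>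
  may be noncommutative.\<close>

lemma scalar_commute:
  assumes "r \<in> carrier R" "a \<in> carrier S"
  shows "(r \<odot>\<^bsub>S\<^esub> \<one>\<^bsub>S\<^esub>) \<otimes>\<^bsub>S\<^esub> a = a \<otimes>\<^bsub>S\<^esub> (r \<odot>\<^bsub>S\<^esub> \<one>\<^bsub>S\<^esub>)"
  using assms by (simp add: A.smult_mult_left A.smult_mult_right)

lemma module_restrict_scalars: "Module.module R (restrict_scalars S M)"
proof (rule moduleI[OF A.R.is_cring])
  show "abelian_group (restrict_scalars S M)"
    by (rule abelian_groupI)
      (auto simp: restrict_scalars_def L.M.a_ac intro: L.M.l_neg)
qed (simp_all add: restrict_scalars_def L.lsmult_closed L.lsmult_r_distr scalar_mult
    L.lsmult_assoc L.lsmult_one A.smult_l_distr L.lsmult_l_distr)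

text \<open>Centrality of the scalars makes their action \<open>S\<close>-linear. The homomorphism
  is what allows ideals of the endomorphism ring to be pulled back to \<open>R\<close>.\<close>

lemma scalar_End: "(\<lambda>r. \<lambda>x\<in>carrier M. (r \<odot>\<^bsub>S\<^esub> \<one>\<^bsub>S\<^esub>) \<odot>\<^bsub>M\<^esub> x) \<in> ring_hom R (module_End S M)"
proof (rule ring_hom_memI)
  fix r assume r: "r \<in> carrier R"
  show "(\<lambda>x\<in>carrier M. (r \<odot>\<^bsub>S\<^esub> \<one>\<^bsub>S\<^esub>) \<odot>\<^bsub>M\<^esub> x) \<in> carrier (module_End S M)"
  proof (rule L.End_memI)
    fix a x assume "a \<in> carrier S" "x \<in> carrier M"
    with r show "(r \<odot>\<^bsub>S\<^esub> \<one>\<^bsub>S\<^esub>) \<odot>\<^bsub>M\<^esub> (a \<odot>\<^bsub>M\<^esub> x) = a \<odot>\<^bsub>M\<^esub> ((r \<odot>\<^bsub>S\<^esub> \<one>\<^bsub>S\<^esub>) \<odot>\<^bsub>M\<^esub> x)"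
      by (metis L.lsmult_assoc scalar_closed scalar_commute)
  qed (simp_all add: r L.lsmult_closed L.lsmult_r_distr)
qed (auto simp: module_End_def fun_eq_iff scalar_mult L.lsmult_assoc L.lsmult_one A.smult_l_distr
    L.lsmult_l_distr L.lsmult_closed)

text \<open>\<open>Q\<close> is the preimage of the ideal of non-units under the scalar action.
  Scalars outside it act as units, hence bijectively.\<close>

lemma local_End_prime:
  assumes "local_ring (module_End S M)"
  obtains Q where "Q \<in> Spec R"
    "\<And>r. r \<in> carrier R - Q \<Longrightarrow> bij_betw (\<lambda>x. r \<odot>\<^bsub>restrict_scalars S M\<^esub> x) (carrier M) (carrier M)"
proof -
  let ?E = "module_End S M"
  let ?h = "\<lambda>r. \<lambda>x\<in>carrier M. (r \<odot>\<^bsub>S\<^esub> \<one>\<^bsub>S\<^esub>) \<odot>\<^bsub>M\<^esub> x"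
  let ?Q = "{r \<in> carrier R. ?h r \<in> carrier ?E - Units ?E}"
  interpret E: ring ?E by (rule L.ring_End)
  interpret h: ring_hom_ring R ?E ?h
    by (rule ring_hom_ringI2[OF A.R.ring_axioms E.ring_axioms scalar_End])
  have "ideal (carrier ?E - Units ?E) ?E"
    using assms by (simp add: local_ring_def)
  from h.ideal_vimage[OF this] have "ideal ?Q R" .
  moreover have "\<one>\<^bsub>R\<^esub> \<notin> ?Q"
    using h.hom_one E.Units_one_closed by simp
  \<comment> \<open>Contraposition: if \<open>a\<close> and \<open>b\<close> both act as units, so
    does their product.\<close>
  moreover have "a \<in> ?Q \<or> b \<in> ?Q"
    if "a \<in> carrier R" "b \<in> carrier R" "a \<otimes>\<^bsub>R\<^esub> b \<in> ?Q" for a b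
    using that h.hom_mult[OF that(1,2)] h.hom_closed E.Units_m_closed[of "?h a" "?h b"]
    by (metis (mono_tags, lifting) DiffD2 DiffI mem_Collect_eq)
  ultimately have "primeideal ?Q R"
    using A.R.one_closed by (intro primeidealI A.R.is_cring) blast+
  moreover have "bij_betw (\<lambda>x. r \<odot>\<^bsub>restrict_scalars S M\<^esub> x) (carrier M) (carrier M)"
    if "r \<in> carrier R - ?Q" for r
  proof -
    have "?h r \<in> Units ?E"
      using that h.hom_closed by auto
    then have "bij_betw (?h r) (carrier M) (carrier M)"
      by (simp add: L.End_Units_iff)
    then show ?thesis
      by (simp add: restrict_scalars_def cong: bij_betw_cong)
  qed
  ultimately show thesis
    using that[of ?Q] by (simp add: Spec_def)
qed

end

section \<open>Localization of a module at a prime\<close>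

lemma (in primeideal) compl_closed:
  "\<one> \<in> carrier R - I"
  "u \<in> carrier R - I \<Longrightarrow> v \<in> carrier R - I \<Longrightarrow> u \<otimes> v \<in> carrier R - I"
  using I_notcarr one_imp_carrier I_prime by auto

locale localization = Module.module R M + P: primeideal P R
  for R :: "('r, 'b) ring_scheme" (structure) and M :: "('r, 'm, 'c) module_scheme" (structure)
    and P :: "'r set"
begin

abbreviation "D \<equiv> carrier R - P"
abbreviation "fr \<equiv> fraction R M P"
abbreviation "L \<equiv> localized_module R M P"

lemmas one_D = P.compl_closed(1)
lemmas mult_D = P.compl_closed(2)

lemma mult_notin [simp]:
  "s \<in> carrier R \<Longrightarrow> t \<in> carrier R \<Longrightarrow> s \<notin> P \<Longrightarrow> t \<notin> P \<Longrightarrow> s \<otimes> t \<notin> P"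
  using P.I_prime by blast

lemma smult_commute:
  "a \<in> carrier R \<Longrightarrow> b \<in> carrier R \<Longrightarrow> x \<in> carrier M \<Longrightarrow> a \<odot>\<^bsub>M\<^esub> (b \<odot>\<^bsub>M\<^esub> x) = b \<odot>\<^bsub>M\<^esub> (a \<odot>\<^bsub>M\<^esub> x)"
  by (metis R.m_comm smult_assoc1)

text \<open>The extra factor in \<open>frac_rel\<close> secures transitivity when \<open>M\<close>
  has torsion: it absorbs the middle denominator.\<close>

lemma equiv_frac_rel: "equiv (carrier M \<times> D) (frac_rel R M P)"
proof (rule equivI)
  show "refl_on (carrier M \<times> D) (frac_rel R M P)"
    using one_D by (force simp: refl_on_def frac_rel_def)
  show "sym (frac_rel R M P)"
    by (force simp: sym_def frac_rel_def)
  show "trans (frac_rel R M P)"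
  proof (rule transI, clarsimp simp: frac_rel_def)
    fix x s y t z r u v
    assume *: "x \<in> carrier M" "y \<in> carrier M" "z \<in> carrier M"
      "s \<in> carrier R" "s \<notin> P" "t \<in> carrier R" "t \<notin> P" "r \<in> carrier R" "r \<notin> P"
      "u \<in> carrier R" "u \<notin> P" "v \<in> carrier R" "v \<notin> P"
      and u: "u \<odot>\<^bsub>M\<^esub> (t \<odot>\<^bsub>M\<^esub> x) = u \<odot>\<^bsub>M\<^esub> (s \<odot>\<^bsub>M\<^esub> y)"
      and v: "v \<odot>\<^bsub>M\<^esub> (r \<odot>\<^bsub>M\<^esub> y) = v \<odot>\<^bsub>M\<^esub> (t \<odot>\<^bsub>M\<^esub> z)"
    \<comment> \<open>Scale the first equation by \<open>v \<otimes> r\<close> and the second by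
      \<open>u \<otimes> s\<close>; the two then share the term in \<open>y\<close>, and the outer
      terms have the common factor \<open>u \<otimes> v \<otimes> t\<close>.\<close>
    have "(u \<otimes> v \<otimes> t) \<odot>\<^bsub>M\<^esub> (r \<odot>\<^bsub>M\<^esub> x) = (v \<otimes> r) \<odot>\<^bsub>M\<^esub> (u \<odot>\<^bsub>M\<^esub> (t \<odot>\<^bsub>M\<^esub> x))"
      using * by (simp add: smult_assoc1[symmetric] R.m_ac)
    also have "\<dots> = (u \<otimes> s) \<odot>\<^bsub>M\<^esub> (v \<odot>\<^bsub>M\<^esub> (r \<odot>\<^bsub>M\<^esub> y))"
      unfolding u using * by (simp add: smult_assoc1[symmetric] R.m_ac)
    also have "\<dots> = (u \<otimes> v \<otimes> t) \<odot>\<^bsub>M\<^esub> (s \<odot>\<^bsub>M\<^esub> z)"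
      unfolding v using * by (simp add: smult_assoc1[symmetric] R.m_ac)
    finally show "\<exists>w\<in>D. w \<odot>\<^bsub>M\<^esub> (r \<odot>\<^bsub>M\<^esub> x) = w \<odot>\<^bsub>M\<^esub> (s \<odot>\<^bsub>M\<^esub> z)"
      using * by (intro bexI[of _ "u \<otimes> v \<otimes> t"] mult_D) auto
  qed
qed (auto simp: frac_rel_def)

lemma frac_eq_iff:
  assumes "x \<in> carrier M" "s \<in> D" "y \<in> carrier M" "t \<in> D"
  shows "fr x s = fr y t \<longleftrightarrow> (\<exists>u\<in>D. u \<odot>\<^bsub>M\<^esub> (t \<odot>\<^bsub>M\<^esub> x) = u \<odot>\<^bsub>M\<^esub> (s \<odot>\<^bsub>M\<^esub> y))"
  unfolding fraction_def using assms eq_equiv_class_iff[OF equiv_frac_rel, of "(x, s)" "(y, t)"]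
  by (simp add: frac_rel_def)

lemma frac_mem: "x \<in> carrier M \<Longrightarrow> s \<in> D \<Longrightarrow> (x, s) \<in> fr x s"
  unfolding fraction_def using equiv_class_self[OF equiv_frac_rel] by blast

lemma mem_fracD:
  assumes "(y, t) \<in> fr x s"
  shows "y \<in> carrier M" "t \<in> D" "\<exists>u\<in>D. u \<odot>\<^bsub>M\<^esub> (t \<odot>\<^bsub>M\<^esub> x) = u \<odot>\<^bsub>M\<^esub> (s \<odot>\<^bsub>M\<^esub> y)"
  using assms unfolding fraction_def frac_rel_def by auto

lemma frac_closed: "x \<in> carrier M \<Longrightarrow> s \<in> D \<Longrightarrow> fr x s \<in> carrier L"
  unfolding localized_module_def fraction_def by (auto intro: quotientI)

lemma frac_cases:
  assumes "z \<in> carrier L"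
  obtains x s where "x \<in> carrier M" "s \<in> D" "z = fr x s"
  using assms unfolding localized_module_def fraction_def by (auto elim!: quotientE)

lemma zero_frac: "\<zero>\<^bsub>L\<^esub> = fr \<zero>\<^bsub>M\<^esub> \<one>"
  by (simp add: localized_module_def)

text \<open>Serves to bring fractions to a common denominator.\<close>

lemma frac_expand:
  assumes "x \<in> carrier M" "s \<in> D" "t \<in> D"
  shows "fr (t \<odot>\<^bsub>M\<^esub> x) (t \<otimes> s) = fr x s"
proof -
  have "\<one> \<odot>\<^bsub>M\<^esub> (s \<odot>\<^bsub>M\<^esub> (t \<odot>\<^bsub>M\<^esub> x)) = \<one> \<odot>\<^bsub>M\<^esub> ((t \<otimes> s) \<odot>\<^bsub>M\<^esub> x)"
    using assms by (simp add: smult_assoc1[symmetric] R.m_comm)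
  then show ?thesis
    using assms one_D by (subst frac_eq_iff) (auto simp: mult_D)
qed

text \<open>Addition in \<open>localized_module\<close> is a union over all pairs of
  representatives. Independence of the representatives makes all the united sets equal, and the
  union collapses to a single class.\<close>

lemma add_frac_gen:
  assumes x: "x \<in> carrier M" and s: "s \<in> D" and y: "y \<in> carrier M" and t: "t \<in> D"
  shows "fr x s \<oplus>\<^bsub>L\<^esub> fr y t = fr (t \<odot>\<^bsub>M\<^esub> x \<oplus>\<^bsub>M\<^esub> s \<odot>\<^bsub>M\<^esub> y) (s \<otimes> t)"
proof -
  let ?f = "\<lambda>x s y t. fr (t \<odot>\<^bsub>M\<^esub> x \<oplus>\<^bsub>M\<^esub> s \<odot>\<^bsub>M\<^esub> y) (s \<otimes> t)"
  have cong: "?f x' s' y' t' = ?f x s y t" if xs: "(x', s') \<in> fr x s" and yt: "(y', t') \<in> fr y t" for x' s' y' t'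
  proof -
    note c = mem_fracD(1,2)[OF xs] mem_fracD(1,2)[OF yt] x s y t
    obtain u v where u: "u \<in> D" "u \<odot>\<^bsub>M\<^esub> (s' \<odot>\<^bsub>M\<^esub> x) = u \<odot>\<^bsub>M\<^esub> (s \<odot>\<^bsub>M\<^esub> x')"
      and v: "v \<in> D" "v \<odot>\<^bsub>M\<^esub> (t' \<odot>\<^bsub>M\<^esub> y) = v \<odot>\<^bsub>M\<^esub> (t \<odot>\<^bsub>M\<^esub> y')"
      using mem_fracD(3)[OF xs] mem_fracD(3)[OF yt] by blast
    \<comment> \<open>The product of the two witnesses works for the sum: \<open>u\<close> exchanges
      the representatives of the first summand, \<open>v\<close> those of the second.\<close>
    have "(u \<otimes> v) \<odot>\<^bsub>M\<^esub> ((s \<otimes> t) \<odot>\<^bsub>M\<^esub> (t' \<odot>\<^bsub>M\<^esub> x' \<oplus>\<^bsub>M\<^esub> s' \<odot>\<^bsub>M\<^esub> y')) =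
        (v \<otimes> t \<otimes> t') \<odot>\<^bsub>M\<^esub> (u \<odot>\<^bsub>M\<^esub> (s \<odot>\<^bsub>M\<^esub> x')) \<oplus>\<^bsub>M\<^esub> (u \<otimes> s \<otimes> s') \<odot>\<^bsub>M\<^esub> (v \<odot>\<^bsub>M\<^esub> (t \<odot>\<^bsub>M\<^esub> y'))"
      using c u(1) v(1) by (simp add: smult_r_distr smult_assoc1[symmetric] R.m_ac)
    also have "\<dots> = (u \<otimes> v) \<odot>\<^bsub>M\<^esub> ((s' \<otimes> t') \<odot>\<^bsub>M\<^esub> (t \<odot>\<^bsub>M\<^esub> x \<oplus>\<^bsub>M\<^esub> s \<odot>\<^bsub>M\<^esub> y))"
      unfolding u(2)[symmetric] v(2)[symmetric]
      using c u(1) v(1) by (simp add: smult_r_distr smult_assoc1[symmetric] R.m_ac)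
    finally show ?thesis
      using c mult_D[OF u(1) v(1)] by (subst frac_eq_iff) (auto simp: mult_D)
  qed
  have "fr x s \<oplus>\<^bsub>L\<^esub> fr y t = (\<Union>p \<in> fr x s. \<Union>q \<in> fr y t. ?f (fst p) (snd p) (fst q) (snd q))"
    by (simp add: localized_module_def case_prod_beta)
  also have "\<dots> = (\<Union>p \<in> fr x s. \<Union>q \<in> fr y t. ?f x s y t)"
    by (intro SUP_cong refl cong) simp_all
  also have "\<dots> = ?f x s y t"
    \<comment> \<open>The union is over nonempty sets, since each class contains its own
      representative.\<close>
    using frac_mem[OF x s] frac_mem[OF y t] by blast
  finally show ?thesis .
qed

text \<open>The union over representatives collapses as for addition; a witness for equal fractions
  still works after scaling both numerators by \<open>r\<close>.\<close>

lemma smult_frac: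
  assumes r: "r \<in> carrier R" and x: "x \<in> carrier M" and s: "s \<in> D"
  shows "r \<odot>\<^bsub>L\<^esub> fr x s = fr (r \<odot>\<^bsub>M\<^esub> x) s"
proof -
  have cong: "fr (r \<odot>\<^bsub>M\<^esub> x') s' = fr (r \<odot>\<^bsub>M\<^esub> x) s" if xs: "(x', s') \<in> fr x s" for x' s'
  proof -
    note c = mem_fracD(1,2)[OF xs] x s r
    obtain u where u: "u \<in> D" "u \<odot>\<^bsub>M\<^esub> (s' \<odot>\<^bsub>M\<^esub> x) = u \<odot>\<^bsub>M\<^esub> (s \<odot>\<^bsub>M\<^esub> x')"
      using mem_fracD(3)[OF xs] by blast
    have "u \<odot>\<^bsub>M\<^esub> (s \<odot>\<^bsub>M\<^esub> (r \<odot>\<^bsub>M\<^esub> x')) = r \<odot>\<^bsub>M\<^esub> (u \<odot>\<^bsub>M\<^esub> (s \<odot>\<^bsub>M\<^esub> x'))"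
      using c u(1) by (simp add: smult_assoc1[symmetric] R.m_ac)
    also have "\<dots> = u \<odot>\<^bsub>M\<^esub> (s' \<odot>\<^bsub>M\<^esub> (r \<odot>\<^bsub>M\<^esub> x))"
      unfolding u(2)[symmetric] using c u(1) by (simp add: smult_assoc1[symmetric] R.m_ac)
    finally show ?thesis
      using c u(1) by (subst frac_eq_iff) auto
  qed
  have "r \<odot>\<^bsub>L\<^esub> fr x s = (\<Union>p \<in> fr x s. fr (r \<odot>\<^bsub>M\<^esub> fst p) (snd p))"
    by (simp add: localized_module_def case_prod_beta)
  also have "\<dots> = (\<Union>p \<in> fr x s. fr (r \<odot>\<^bsub>M\<^esub> x) s)"
    by (intro SUP_cong refl cong) simp_all
  also have "\<dots> = fr (r \<odot>\<^bsub>M\<^esub> x) s"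
    using frac_mem[OF x s] by blast
  finally show ?thesis .
qed

lemma add_frac:
  assumes "x \<in> carrier M" "y \<in> carrier M" "s \<in> D"
  shows "fr x s \<oplus>\<^bsub>L\<^esub> fr y s = fr (x \<oplus>\<^bsub>M\<^esub> y) s"
  using assms frac_expand[of "x \<oplus>\<^bsub>M\<^esub> y" s s] by (simp add: add_frac_gen smult_r_distr)

text \<open>With a common denominator, additive laws in \<open>L\<close> become laws for the
  numerators in \<open>M\<close>.\<close>

lemma frac_cases_common:
  assumes "z \<in> carrier L" "w \<in> carrier L"
  obtains x y s where "x \<in> carrier M" "y \<in> carrier M" "s \<in> D" "z = fr x s" "w = fr y s"
proof -
  obtain x s y t where c: "x \<in> carrier M" "s \<in> D" "z = fr x s" "y \<in> carrier M" "t \<in> D" "w = fr y t"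
    using assms by (elim frac_cases) blast
  then have "z = fr (t \<odot>\<^bsub>M\<^esub> x) (s \<otimes> t)" "w = fr (s \<odot>\<^bsub>M\<^esub> y) (s \<otimes> t)"
    using frac_expand[of x s t] frac_expand[of y t s] by (simp_all add: R.m_comm)
  then show thesis
    using that c mult_D[of s t] by blast
qed

lemma zero_frac': "s \<in> D \<Longrightarrow> \<zero>\<^bsub>L\<^esub> = fr \<zero>\<^bsub>M\<^esub> s"
  using frac_expand[of "\<zero>\<^bsub>M\<^esub>" \<one> s] one_D by (simp add: zero_frac)

lemma abelian_group_localized: "abelian_group L"
proof (rule abelian_groupI)
  fix z w assume "z \<in> carrier L" "w \<in> carrier L"
  then obtain x y s where c: "x \<in> carrier M" "y \<in> carrier M" "s \<in> D" "z = fr x s" "w = fr y s"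
    by (rule frac_cases_common)
  then show "z \<oplus>\<^bsub>L\<^esub> w \<in> carrier L" "z \<oplus>\<^bsub>L\<^esub> w = w \<oplus>\<^bsub>L\<^esub> z"
    by (simp_all add: add_frac frac_closed M.a_comm)
next
  fix z w q assume zw: "z \<in> carrier L" "w \<in> carrier L" and q: "q \<in> carrier L"
  from zw obtain x y s where c: "x \<in> carrier M" "y \<in> carrier M" "s \<in> D" "z = fr x s" "w = fr y s"
    by (rule frac_cases_common)
  from q obtain v t where d: "v \<in> carrier M" "t \<in> D" "q = fr v t"
    by (rule frac_cases)
  have "z = fr (t \<odot>\<^bsub>M\<^esub> x) (s \<otimes> t)" "w = fr (t \<odot>\<^bsub>M\<^esub> y) (s \<otimes> t)" "q = fr (s \<odot>\<^bsub>M\<^esub> v) (s \<otimes> t)"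
    using c d frac_expand[of x s t] frac_expand[of y s t] frac_expand[of v t s] by (simp_all add: R.m_comm)
  then show "(z \<oplus>\<^bsub>L\<^esub> w) \<oplus>\<^bsub>L\<^esub> q = z \<oplus>\<^bsub>L\<^esub> (w \<oplus>\<^bsub>L\<^esub> q)"
    using c d mult_D[of s t] by (simp add: add_frac M.a_assoc)
next
  fix z assume "z \<in> carrier L"
  then obtain x s where c: "x \<in> carrier M" "s \<in> D" "z = fr x s"
    by (rule frac_cases)
  then show "\<zero>\<^bsub>L\<^esub> \<oplus>\<^bsub>L\<^esub> z = z"
    by (simp add: zero_frac'[of s] add_frac)
  have "fr (\<ominus>\<^bsub>M\<^esub> x) s \<oplus>\<^bsub>L\<^esub> z = \<zero>\<^bsub>L\<^esub>"
    using c by (simp add: zero_frac'[of s] add_frac M.l_neg)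
  then show "\<exists>w\<in>carrier L. w \<oplus>\<^bsub>L\<^esub> z = \<zero>\<^bsub>L\<^esub>"
    using c frac_closed[of "\<ominus>\<^bsub>M\<^esub> x" s] by auto
qed (simp add: zero_frac frac_closed one_D[simplified])

lemma module_localized: "Module.module R L"
proof (rule moduleI[OF R.is_cring abelian_group_localized])
  fix a z w assume "a \<in> carrier R" "z \<in> carrier L" "w \<in> carrier L"
  moreover from this(2,3) obtain x y s
    where "x \<in> carrier M" "y \<in> carrier M" "s \<in> D" "z = fr x s" "w = fr y s"
    by (rule frac_cases_common)
  ultimately show "a \<odot>\<^bsub>L\<^esub> (z \<oplus>\<^bsub>L\<^esub> w) = a \<odot>\<^bsub>L\<^esub> z \<oplus>\<^bsub>L\<^esub> a \<odot>\<^bsub>L\<^esub> w"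
    by (simp add: add_frac smult_frac smult_r_distr)
qed (auto elim!: frac_cases simp: smult_frac frac_closed add_frac smult_l_distr smult_assoc1)

lemma frac_eq_zero_iff:
  assumes "x \<in> carrier M" "s \<in> D"
  shows "fr x s = \<zero>\<^bsub>L\<^esub> \<longleftrightarrow> (\<exists>u\<in>D. u \<odot>\<^bsub>M\<^esub> x = \<zero>\<^bsub>M\<^esub>)"
  using assms one_D by (simp add: zero_frac frac_eq_iff)

text \<open>Elements outside \<open>P\<close> can be divided by in only one way: the witness
  \<open>u\<close> for the hypothesis also proves the conclusion. Used to evaluate endomorphisms of
  a localization.\<close>

lemma smult_D_cancel:
  assumes "z \<in> carrier L" "x \<in> carrier M" "s \<in> D" "t \<in> D" "t \<odot>\<^bsub>L\<^esub> z = fr x s"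
  shows "z = fr x (t \<otimes> s)"
proof -
  obtain y r where y: "y \<in> carrier M" "r \<in> D" "z = fr y r"
    using assms(1) by (rule frac_cases)
  then obtain u where u: "u \<in> D" "u \<odot>\<^bsub>M\<^esub> (s \<odot>\<^bsub>M\<^esub> (t \<odot>\<^bsub>M\<^esub> y)) = u \<odot>\<^bsub>M\<^esub> (r \<odot>\<^bsub>M\<^esub> x)"
    using assms frac_eq_iff[of "t \<odot>\<^bsub>M\<^esub> y" r x s] by (auto simp: smult_frac)
  have "u \<odot>\<^bsub>M\<^esub> ((t \<otimes> s) \<odot>\<^bsub>M\<^esub> y) = u \<odot>\<^bsub>M\<^esub> (r \<odot>\<^bsub>M\<^esub> x)"
    using assms y u by (simp add: smult_assoc1 smult_commute[of s t])
  then show ?thesis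
    using assms y u mult_D[of t s] by (auto simp: frac_eq_iff)
qed

end

text \<open>A fraction vanishes exactly when some element outside \<open>P\<close> kills its
  numerator. Hence membership in the support says that some \<open>x\<close> has its annihilator
  inside \<open>P\<close>, and no fractions are needed to use it.\<close>

lemma (in Module.module) mem_Supp_iff:
  "P \<in> Supp R M \<longleftrightarrow>
    P \<in> Spec R \<and> (\<exists>x\<in>carrier M. \<forall>u\<in>carrier R - P. u \<odot>\<^bsub>M\<^esub> x \<noteq> \<zero>\<^bsub>M\<^esub>)"
proof (cases "P \<in> Spec R")
  case True
  then interpret P: primeideal P R by (simp add: Spec_def)
  interpret localization R M P ..
  have "carrier L \<noteq> {\<zero>\<^bsub>L\<^esub>} \<longleftrightarrow> (\<exists>z\<in>carrier L. z \<noteq> \<zero>\<^bsub>L\<^esub>)"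
    using frac_closed[OF M.zero_closed one_D] zero_frac by auto
  also have "\<dots> \<longleftrightarrow> (\<exists>x\<in>carrier M. \<forall>u\<in>D. u \<odot>\<^bsub>M\<^esub> x \<noteq> \<zero>\<^bsub>M\<^esub>)"
  proof
    assume "\<exists>z\<in>carrier L. z \<noteq> \<zero>\<^bsub>L\<^esub>"
    then obtain z where z: "z \<in> carrier L" "z \<noteq> \<zero>\<^bsub>L\<^esub>" by blast
    obtain x s where "x \<in> carrier M" "s \<in> D" "z = fr x s"
      using z(1) by (rule frac_cases)
    then show "\<exists>x\<in>carrier M. \<forall>u\<in>D. u \<odot>\<^bsub>M\<^esub> x \<noteq> \<zero>\<^bsub>M\<^esub>"
      using frac_eq_zero_iff z(2) by blast
  next
    assume "\<exists>x\<in>carrier M. \<forall>u\<in>D. u \<odot>\<^bsub>M\<^esub> x \<noteq> \<zero>\<^bsub>M\<^esub>"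
    then obtain x where x: "x \<in> carrier M" "\<forall>u\<in>D. u \<odot>\<^bsub>M\<^esub> x \<noteq> \<zero>\<^bsub>M\<^esub>" by blast
    then have "fr x \<one> \<noteq> \<zero>\<^bsub>L\<^esub>"
      using frac_eq_zero_iff[OF x(1) one_D] by blast
    then show "\<exists>z\<in>carrier L. z \<noteq> \<zero>\<^bsub>L\<^esub>"
      using frac_closed[OF x(1) one_D] by blast
  qed
  finally show ?thesis
    using True by (simp add: Supp_def)
qed (simp add: Supp_def)

section \<open>From minimal primes to supports of modules\<close>

lemma module_local_End_minimal_prime:
  fixes R :: "('r, 'b) ring_scheme" and S :: "('r, 's, 'c) module_scheme" and M :: "('s, 'm, 'd) module_scheme"
  assumes alg: "assoc_algebra R S" and lmod: "left_module S M" and loc: "local_ring (module_End S M)"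
    and unique: "\<forall>P \<in> Spec R. \<exists>!A. minimal_prime R A \<and> A \<subseteq> P"
  shows "\<exists>!A. minimal_prime R A \<and> Supp R (restrict_scalars S M) \<subseteq> V R A"
proof -
  let ?N = "restrict_scalars S M"
  interpret N: Module.module R ?N
    using alg lmod by (rule module_restrict_scalars)
  interpret M: left_module S M by (fact lmod)
  interpret E: ring "module_End S M" by (rule M.ring_End)
  obtain Q where Q: "Q \<in> Spec R"
    and bij: "\<And>r. r \<in> carrier R - Q \<Longrightarrow> bij_betw (\<lambda>x. r \<odot>\<^bsub>?N\<^esub> x) (carrier M) (carrier M)"
    using local_End_prime[OF alg lmod loc] by blast
  have carr: "carrier ?N = carrier M" and zero: "\<zero>\<^bsub>?N\<^esub> = \<zero>\<^bsub>M\<^esub>"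
    by (simp_all add: restrict_scalars_def)
  interpret Q: primeideal Q R using Q by (simp add: Spec_def)
  \<comment> \<open>The zero module has the zero ring as endomorphism ring, which is not
    local.\<close>
  have ex: "\<exists>x\<in>carrier M. x \<noteq> \<zero>\<^bsub>M\<^esub>"
  proof (rule ccontr)
    assume zero_only: "\<not> (\<exists>x\<in>carrier M. x \<noteq> \<zero>\<^bsub>M\<^esub>)"
    have "f = \<zero>\<^bsub>module_End S M\<^esub>" if "f \<in> carrier (module_End S M)" for f
    proof (rule M.End_ext[OF that M.End_zero_closed])
      fix x assume "x \<in> carrier M"
      then show "f x = \<zero>\<^bsub>module_End S M\<^esub> x"
        using zero_only M.End_closed[OF that] M.End_closed[OF M.End_zero_closed] by metis
    qed
    then show False
      using loc E.zero_closed unfolding local_ring_def by blast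
  qed
  have inj: "r \<odot>\<^bsub>?N\<^esub> x \<noteq> \<zero>\<^bsub>M\<^esub>" if "r \<in> carrier R - Q" "x \<in> carrier M" "x \<noteq> \<zero>\<^bsub>M\<^esub>" for r x
    using that bij[OF that(1)] N.smult_r_null[of r] M.M.zero_closed unfolding zero bij_betw_def
    by (metis DiffD1 inj_onD)
  \<comment> \<open>Scalars outside \<open>Q\<close> act injectively, so the annihilator of any
    nonzero \<open>x\<close> lies in \<open>Q\<close>.\<close>
  have Q_Supp: "Q \<in> Supp R ?N"
    using Q ex inj by (auto simp: N.mem_Supp_iff carr zero)
  obtain A where A: "minimal_prime R A" "A \<subseteq> Q"
    and A_unique: "\<And>B. minimal_prime R B \<Longrightarrow> B \<subseteq> Q \<Longrightarrow> B = A"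
    using unique Q by metis
  have "A \<subseteq> P" if "P \<in> Supp R ?N" for P
  proof -
    have P: "P \<in> Spec R" and "\<exists>x\<in>carrier M. \<forall>u\<in>carrier R - P. u \<odot>\<^bsub>?N\<^esub> x \<noteq> \<zero>\<^bsub>M\<^esub>"
      using that by (simp_all add: N.mem_Supp_iff carr zero)
    then obtain x where x: "x \<in> carrier M" "\<And>u. u \<in> carrier R - P \<Longrightarrow> u \<odot>\<^bsub>?N\<^esub> x \<noteq> \<zero>\<^bsub>M\<^esub>"
      by blast
    interpret P: primeideal P R using P by (simp add: Spec_def)
    \<comment> \<open>This multiplicative set contains the complements of \<open>P\<close> and of
      \<open>Q\<close>, so a prime that misses it lies in both.\<close>
    let ?T = "{p \<otimes>\<^bsub>R\<^esub> q | p q. p \<in> carrier R - P \<and> q \<in> carrier R - Q}"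
    have T_I: "p \<otimes>\<^bsub>R\<^esub> q \<in> ?T" if "p \<in> carrier R - P" "q \<in> carrier R - Q" for p q
      using that by blast
    obtain P' where P': "primeideal P' R" "P' \<inter> ?T = {}"
    proof (rule N.R.exists_primeideal_disjoint)
      show "?T \<subseteq> carrier R" by auto
      show "\<one>\<^bsub>R\<^esub> \<in> ?T"
        using T_I[OF P.compl_closed(1) Q.compl_closed(1)] N.R.r_one[OF N.R.one_closed] by argo
      show "\<zero>\<^bsub>R\<^esub> \<notin> ?T"
      proof
        assume "\<zero>\<^bsub>R\<^esub> \<in> ?T"
        then obtain p q where pq: "p \<in> carrier R - P" "q \<in> carrier R - Q" "\<zero>\<^bsub>R\<^esub> = p \<otimes>\<^bsub>R\<^esub> q"
          by blast
        \<comment> \<open>Surjectivity of the action of \<open>q\<close> moves the relation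
          \<open>pq = 0\<close> onto \<open>x\<close>: from \<open>x = qy\<close> follows
          \<open>px = (pq)y = 0\<close>, although no element outside \<open>P\<close> kills
          \<open>x\<close>.\<close>
        obtain y where y: "y \<in> carrier M" "x = q \<odot>\<^bsub>?N\<^esub> y"
          using bij[OF pq(2)] x(1) unfolding bij_betw_def by blast
        have "p \<odot>\<^bsub>?N\<^esub> x = (p \<otimes>\<^bsub>R\<^esub> q) \<odot>\<^bsub>?N\<^esub> y"
          using pq y N.smult_assoc1[of p q y] by (simp add: carr)
        also have "\<dots> = \<zero>\<^bsub>M\<^esub>"
          unfolding pq(3)[symmetric] using N.smult_l_null[of y] y(1) by (simp add: carr zero)
        finally show False
          using x(2) pq(1) by blast
      qed
    next
      fix s t assume "s \<in> ?T" "t \<in> ?T"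
      then obtain p q p' q' where *: "p \<in> carrier R - P" "q \<in> carrier R - Q" "p' \<in> carrier R - P"
        "q' \<in> carrier R - Q" "s = p \<otimes>\<^bsub>R\<^esub> q" "t = p' \<otimes>\<^bsub>R\<^esub> q'"
        by blast
      then have eq: "s \<otimes>\<^bsub>R\<^esub> t = (p \<otimes>\<^bsub>R\<^esub> p') \<otimes>\<^bsub>R\<^esub> (q \<otimes>\<^bsub>R\<^esub> q')"
        by (simp add: N.R.m_ac)
      show "s \<otimes>\<^bsub>R\<^esub> t \<in> ?T"
        unfolding eq using * by (intro T_I P.compl_closed(2) Q.compl_closed(2))
    qed
    have "p \<in> ?T" if "p \<in> carrier R - P" for p
      using T_I[OF that Q.compl_closed(1)] that by (simp del: mem_Collect_eq)
    moreover have "q \<in> ?T" if "q \<in> carrier R - Q" for q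
      using T_I[OF P.compl_closed(1) that] that by (simp del: mem_Collect_eq)
    moreover have "P' \<subseteq> carrier R"
      using P'(1) by (simp add: additive_subgroup.a_subset ideal.axioms(1) primeideal.axioms(1))
    ultimately have sub: "P' \<subseteq> P" "P' \<subseteq> Q"
      using P'(2) by blast+
    \<comment> \<open>A minimal prime below \<open>P'\<close> is also below \<open>Q\<close>, where
      \<open>A\<close> is the only one.\<close>
    obtain B where B: "minimal_prime R B" "B \<subseteq> P'"
      using unique P'(1) unfolding Spec_def by blast
    then have "B = A"
      using A_unique sub by blast
    with B sub show ?thesis by blast
  qed
  then have "Supp R ?N \<subseteq> V R A"
    by (auto simp: V_def Supp_def)
  \<comment> \<open>Since \<open>Q\<close> is in the support, any competitor \<open>B\<close> lies
    below \<open>Q\<close>.\<close>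
  moreover have "B = A" if "minimal_prime R B" "Supp R ?N \<subseteq> V R B" for B
    using that Q_Supp A_unique by (auto simp: V_def)
  ultimately show ?thesis
    using A(1) by blast
qed

section \<open>R as an algebra and a module over itself\<close>

text \<open>The fields \<open>mult\<close> and \<open>one\<close> keep the ring structure of
  \<open>R\<close>, so this one record serves as the algebra \<open>S\<close> and also as the module
  to be localized.\<close>

definition regular_module :: "('a, 'b) ring_scheme \<Rightarrow> ('a, 'a) module" where
  "regular_module R = \<lparr>carrier = carrier R, monoid.mult = monoid.mult R, one = \<one>\<^bsub>R\<^esub>,
     zero = \<zero>\<^bsub>R\<^esub>, ring.add = ring.add R, smult = monoid.mult R\<rparr>"

lemma regular_module_simps [simp]:
  "carrier (regular_module R) = carrier R"
  "monoid.mult (regular_module R) = monoid.mult R"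
  "monoid.one (regular_module R) = monoid.one R"
  "ring.zero (regular_module R) = ring.zero R"
  "ring.add (regular_module R) = ring.add R"
  "smult (regular_module R) = monoid.mult R"
  by (simp_all add: regular_module_def)

context cring
begin

lemma ring_regular: "ring (regular_module R)"
proof (rule ringI)
  show "abelian_group (regular_module R)"
    by (rule abelian_groupI) (auto simp: a_ac intro: l_neg)
  show "Group.monoid (regular_module R)"
    by (rule Group.monoidI) (simp_all add: m_assoc)
qed (simp_all add: l_distr r_distr)

lemma module_regular: "Module.module R (regular_module R)"
  by (rule moduleI[OF is_cring ring.is_abelian_group[OF ring_regular]])
    (simp_all add: l_distr r_distr m_assoc)

lemma assoc_algebra_regular: "assoc_algebra R (regular_module R)"
  by (intro assoc_algebra.intro module_regular ring_regular assoc_algebra_axioms.intro)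
    (simp_all add: m_ac)

end

lemma (in Module.module) left_module_regular: "left_module (regular_module R) M"
  by (intro left_module.intro R.ring_regular left_module_axioms.intro M.abelian_group_axioms)
    (simp_all add: smult_l_distr smult_r_distr smult_assoc1)

section \<open>The endomorphism ring and support of the localization of R at P\<close>

text \<open>The localization enters only as an \<open>R\<close>-module. In place of a multiplication
  of fractions, endomorphisms are compared through their values at \<open>1/1\<close>.\<close>

locale ring_localization = cring R + P: primeideal P R
  for R :: "('r, 'b) ring_scheme" (structure) and P :: "'r set"
begin

sublocale loc: localization R "regular_module R" P
  by (intro localization.intro module_regular P.primeideal_axioms)

abbreviation "L \<equiv> loc.L"
abbreviation "fr \<equiv> loc.fr"
abbreviation "D \<equiv> carrier R - P"
abbreviation "E \<equiv> module_End (regular_module R) L"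

sublocale mod: Module.module R L
  by (rule loc.module_localized)

sublocale lmod: left_module "regular_module R" L
  by (rule mod.left_module_regular)

text \<open>Linearity gives \<open>t f(b/t) = f(b/1) = b f(1/1)\<close>, and division by
  \<open>t\<close> is unique. Thus \<open>f\<close> is multiplication by \<open>a/s\<close>.\<close>

lemma End_eval:
  assumes f: "f \<in> carrier E" and a: "a \<in> carrier R" and s: "s \<in> D" and fa: "f (fr \<one> \<one>) = fr a s"
    and b: "b \<in> carrier R" and t: "t \<in> D"
  shows "f (fr b t) = fr (b \<otimes> a) (t \<otimes> s)"
proof (rule loc.smult_D_cancel)
  note one = P.compl_closed(1)
  have "t \<odot>\<^bsub>L\<^esub> fr b t = b \<odot>\<^bsub>L\<^esub> fr \<one> \<one>"
    using b t one loc.frac_expand[of b \<one> t] by (simp add: loc.smult_frac)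
  then have "t \<odot>\<^bsub>L\<^esub> f (fr b t) = b \<odot>\<^bsub>L\<^esub> f (fr \<one> \<one>)"
    using lmod.End_smult[OF f] b t one by (metis DiffD1 loc.frac_closed one_closed regular_module_simps(1))
  then show "t \<odot>\<^bsub>L\<^esub> f (fr b t) = fr (b \<otimes> a) s"
    using a b s by (simp add: fa loc.smult_frac)
  show "f (fr b t) \<in> carrier L"
    using b t by (intro lmod.End_closed[OF f] loc.frac_closed) auto
qed (use a s t b in auto)

text \<open>By \<open>End_eval\<close>, \<open>f\<close> is multiplication by \<open>a/s\<close>. As
  \<open>a\<close> is outside \<open>P\<close>, the fraction \<open>s/a\<close> exists and yields
  preimages.\<close>

lemma End_unit:
  assumes f: "f \<in> carrier E" and a: "a \<in> D" and s: "s \<in> D" and fa: "f (fr \<one> \<one>) = fr a s"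
  shows "f \<in> Units E"
proof -
  have eval: "f (fr b t) = fr (b \<otimes> a) (t \<otimes> s)" if "b \<in> carrier R" "t \<in> D" for b t
    using End_eval[OF f _ s fa] a that by blast
  have eval': "f (fr (s \<otimes> b) (a \<otimes> t)) = fr b t" if "b \<in> carrier R" "t \<in> D" for b t
  proof -
    have "f (fr (s \<otimes> b) (a \<otimes> t)) = fr ((s \<otimes> b) \<otimes> a) ((a \<otimes> t) \<otimes> s)"
      using that a s by (intro eval) auto
    also have "\<dots> = fr ((s \<otimes> a) \<otimes> b) ((s \<otimes> a) \<otimes> t)"
      using that a s by (simp add: m_ac)
    also have "\<dots> = fr b t"
      using that a s loc.frac_expand[of b t "s \<otimes> a"] by simp
    finally show ?thesis .
  qed
  \<comment> \<open>If \<open>u\<close> kills \<open>b \<otimes> a\<close>, then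
    \<open>u \<otimes> a\<close>, still outside \<open>P\<close>, kills \<open>b\<close>.\<close>
  have inj: "w = \<zero>\<^bsub>L\<^esub>" if w: "w \<in> carrier L" "f w = \<zero>\<^bsub>L\<^esub>" for w
  proof -
    obtain b t where b: "b \<in> carrier R" "t \<in> D" "w = fr b t"
      using loc.frac_cases[OF w(1)] by (metis regular_module_simps(1))
    then obtain u where "u \<in> D" "u \<otimes> (b \<otimes> a) = \<zero>"
      using w(2) eval[of b t] a s loc.frac_eq_zero_iff[of "b \<otimes> a" "t \<otimes> s"] by auto
    then have "u \<otimes> a \<in> D" "(u \<otimes> a) \<otimes> b = \<zero>"
      using a b by (simp_all add: m_ac)
    then show ?thesis
      using b loc.frac_eq_zero_iff[of b t] by auto
  qed
  have "inj_on f (carrier L)"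
  proof (rule inj_onI)
    fix v w assume vw: "v \<in> carrier L" "w \<in> carrier L" "f v = f w"
    \<comment> \<open>Writing the negative as a multiple by minus one lets the linearity of
      \<open>f\<close> apply to it.\<close>
    let ?m = "\<ominus> \<one> \<odot>\<^bsub>L\<^esub> w"
    have m: "?m = \<ominus>\<^bsub>L\<^esub> w"
      using vw by (simp add: mod.smult_l_minus)
    have "f ?m = \<ominus>\<^bsub>L\<^esub> f w"
      using lmod.End_smult[OF f, of "\<ominus> \<one>" w] vw lmod.End_closed[OF f] by (simp add: mod.smult_l_minus)
    then have "f (v \<oplus>\<^bsub>L\<^esub> ?m) = \<zero>\<^bsub>L\<^esub>"
      using vw lmod.End_closed[OF f] by (simp add: lmod.End_add[OF f] mod.M.r_neg)
    then have "v \<oplus>\<^bsub>L\<^esub> \<ominus>\<^bsub>L\<^esub> w = \<zero>\<^bsub>L\<^esub>"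
      using inj vw m by simp
    then show "v = w"
      using vw by (metis mod.M.a_inv_closed mod.M.minus_equality mod.M.minus_minus)
  qed
  moreover have "f ` carrier L = carrier L"
  proof (intro equalityI subsetI)
    fix z assume "z \<in> f ` carrier L"
    then show "z \<in> carrier L" using lmod.End_closed[OF f] by auto
  next
    fix z assume "z \<in> carrier L"
    then obtain b t where b: "b \<in> carrier R" "t \<in> D" "z = fr b t"
      by (metis loc.frac_cases regular_module_simps(1))
    then have "z = f (fr (s \<otimes> b) (a \<otimes> t))" "fr (s \<otimes> b) (a \<otimes> t) \<in> carrier L"
      using a s eval' by (simp_all add: loc.frac_closed)
    then show "z \<in> f ` carrier L" by blast
  qed
  ultimately show ?thesis
    using f by (simp add: lmod.End_Units_iff bij_betw_def)
qed

text \<open>Under evaluation at \<open>1/1\<close>, the set \<open>?K\<close> corresponds to the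
  maximal ideal of the localization: the fractions with a numerator in \<open>P\<close>.\<close>

lemma local_ring_End_localization: "local_ring E"
proof (rule local_ringI)
  show E: "ring E" by (rule lmod.ring_End)
  then interpret E: ring E .
  note one = P.compl_closed(1)
  let ?e = "fr \<one> \<one>"
  let ?K = "{f \<in> carrier E. \<exists>a\<in>P. \<exists>s\<in>D. f ?e = fr a s}"
  have e: "?e \<in> carrier L"
    using one by (simp add: loc.frac_closed)
  have eval_e: "\<exists>a\<in>carrier R. \<exists>s\<in>D. f ?e = fr a s" if "f \<in> carrier E" for f
    using lmod.End_closed[OF that e] by (metis loc.frac_cases regular_module_simps(1))
  show "ideal ?K E"
  proof (rule idealI[OF E])
    show "subgroup ?K (add_monoid E)"
    proof (rule E.add.subgroupI)
      show "?K \<noteq> {}"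
        using P.zero_closed one e E.zero_closed loc.zero_frac lmod.End_apply(4)[OF e]
        by (simp, metis)
    next
      fix f assume "f \<in> ?K"
      then obtain a s where f: "f \<in> carrier E" "a \<in> P" "s \<in> D" "f ?e = fr a s" by blast
      have "(\<ominus>\<^bsub>E\<^esub> f) ?e = \<ominus> \<one> \<odot>\<^bsub>L\<^esub> fr a s"
        using f e P.Icarr lmod.End_closed[OF f(1) e]
        by (simp add: lmod.End_a_inv_apply mod.smult_l_minus)
      also have "\<dots> = fr (\<ominus> a) s"
        using f P.Icarr by (simp add: loc.smult_frac l_minus)
      finally show "\<ominus>\<^bsub>E\<^esub> f \<in> ?K"
        using f P.a_inv_closed by blast
    next
      fix f g assume "f \<in> ?K" "g \<in> ?K"
      then obtain a s b t where *: "f \<in> carrier E" "a \<in> P" "s \<in> D" "f ?e = fr a s"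
        "g \<in> carrier E" "b \<in> P" "t \<in> D" "g ?e = fr b t" by blast
      have "(f \<oplus>\<^bsub>E\<^esub> g) ?e = fr (t \<otimes> a \<oplus> s \<otimes> b) (s \<otimes> t)"
        using * e P.Icarr loc.add_frac_gen[of a s b t] by (simp add: lmod.End_apply)
      moreover have "t \<otimes> a \<oplus> s \<otimes> b \<in> P"
        using * by (intro P.a_closed P.I_l_closed) auto
      moreover have "s \<otimes> t \<in> D"
        using * by (intro P.compl_closed)
      ultimately show "f \<oplus>\<^bsub>E\<^esub> g \<in> ?K"
        using * by blast
    qed auto
  next
    fix f g assume f: "f \<in> ?K" and g: "g \<in> carrier E"
    obtain a s where f: "f \<in> carrier E" "a \<in> P" "s \<in> D" "f ?e = fr a s"
      using f by blast
    obtain b t where b: "b \<in> carrier R" "t \<in> D" "g ?e = fr b t"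
      using eval_e[OF g] by blast
    have a: "a \<in> carrier R" using f(2) P.Icarr by blast
    \<comment> \<open>Composition multiplies the values at \<open>1/1\<close>, so one factor with
      numerator in \<open>P\<close> suffices, on either side.\<close>
    have "(g \<otimes>\<^bsub>E\<^esub> f) ?e = fr (a \<otimes> b) (s \<otimes> t)" "(f \<otimes>\<^bsub>E\<^esub> g) ?e = fr (b \<otimes> a) (t \<otimes> s)"
      using e f b a End_eval[OF g b(1,2,3) a f(3)] End_eval[OF f(1) a f(3,4) b(1,2)]
      by (simp_all add: lmod.End_apply)
    moreover have "a \<otimes> b \<in> P" "b \<otimes> a \<in> P"
      using f b P.I_l_closed P.I_r_closed by auto
    moreover have "s \<otimes> t \<in> D" "t \<otimes> s \<in> D"
      using f b by (auto intro: P.compl_closed)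
    ultimately show "g \<otimes>\<^bsub>E\<^esub> f \<in> ?K" "f \<otimes>\<^bsub>E\<^esub> g \<in> ?K"
      using f g lmod.End_mult_closed by blast+
  qed
  show "\<one>\<^bsub>E\<^esub> \<notin> ?K"
  proof
    assume "\<one>\<^bsub>E\<^esub> \<in> ?K"
    then obtain a s where a: "a \<in> P" "s \<in> D" "?e = fr a s"
      using lmod.End_apply(3)[OF e] by auto
    \<comment> \<open>Equality of \<open>1/1\<close> and \<open>a/s\<close> would put
      \<open>u \<otimes> s\<close> into \<open>P\<close>, with both factors outside
      \<open>P\<close>.\<close>
    then obtain u where u: "u \<in> D" "u \<otimes> s = u \<otimes> a"
      using loc.frac_eq_iff[of \<one> \<one> a s] one P.Icarr by auto
    have "u \<otimes> s \<in> P"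
      using u a P.I_l_closed by auto
    then show False
      using P.compl_closed(2)[OF u(1) a(2)] by blast
  qed
  show "carrier E - ?K \<subseteq> Units E"
  proof
    \<comment> \<open>Outside \<open>?K\<close> no representation of the value has its numerator in
      \<open>P\<close>, so whichever \<open>a\<close> is obtained lies outside
      \<open>P\<close>.\<close>
    fix f assume f: "f \<in> carrier E - ?K"
    then obtain a s where "a \<in> carrier R" "s \<in> D" "f ?e = fr a s"
      using eval_e by blast
    with f show "f \<in> Units E"
      using End_unit by blast
  qed
qed

text \<open>The annihilator of \<open>1/1\<close> lies in \<open>B\<close>: if
  \<open>u/1 = 0\<close>, then \<open>vu = 0\<close> for some \<open>v\<close> outside
  \<open>P\<close>, hence outside \<open>B\<close>, which forces \<open>u\<close> into
  \<open>B\<close>.\<close>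

lemma mem_Supp_localization:
  assumes "B \<in> Spec R" "B \<subseteq> P"
  shows "B \<in> Supp R (restrict_scalars (regular_module R) L)"
proof -
  let ?N = "restrict_scalars (regular_module R) L"
  interpret N: Module.module R ?N
    by (rule module_restrict_scalars[OF assoc_algebra_regular lmod.left_module_axioms])
  interpret B: primeideal B R using assms(1) by (simp add: Spec_def)
  note one = P.compl_closed(1)
  have "u \<odot>\<^bsub>?N\<^esub> fr \<one> \<one> \<noteq> \<zero>\<^bsub>?N\<^esub>" if u: "u \<in> carrier R - B" for u
  proof
    assume "u \<odot>\<^bsub>?N\<^esub> fr \<one> \<one> = \<zero>\<^bsub>?N\<^esub>"
    then have "fr u \<one> = \<zero>\<^bsub>L\<^esub>"
      using u one by (simp add: restrict_scalars_def loc.smult_frac)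
    then obtain v where v: "v \<in> D" "v \<otimes> u = \<zero>"
      using u one loc.frac_eq_zero_iff[of u \<one>] by auto
    then have "v \<otimes> u \<in> carrier R - B"
      using u assms(2) by (intro B.compl_closed) auto
    then show False
      using v(2) B.zero_closed by simp
  qed
  moreover have "fr \<one> \<one> \<in> carrier ?N"
    using one by (simp add: restrict_scalars_def loc.frac_closed)
  ultimately show ?thesis
    using assms(1) N.mem_Supp_iff by blast
qed

end

section \<open>The equivalence over fixed types and the implication over arbitrary types\<close>

theorem proposition4p4:
  fixes R :: "('a, 'b) ring_scheme"
  assumes "cring R"
  shows
    "((\<forall>(S :: ('a, 'a) module) (M :: ('a, ('a \<times> 'a) set) module).
          assoc_algebra R S \<and> left_module S M \<and> local_ring (module_End S M) \<longrightarrow>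
          (\<exists>!A. minimal_prime R A \<and> Supp R (restrict_scalars S M) \<subseteq> V R A))
       \<longleftrightarrow> (\<forall>P \<in> Spec R. \<exists>!A. minimal_prime R A \<and> A \<subseteq> P))
     \<and>
     ((\<forall>P \<in> Spec R. \<exists>!A. minimal_prime R A \<and> A \<subseteq> P) \<longrightarrow>
       (\<forall>(S :: ('a, 's) module) (M :: ('s, 'm) module).
          assoc_algebra R S \<and> left_module S M \<and> local_ring (module_End S M) \<longrightarrow>
          (\<exists>!A. minimal_prime R A \<and> Supp R (restrict_scalars S M) \<subseteq> V R A)))"
proof (intro conjI iffI ballI impI allI)
  fix P
  assume *: "\<forall>(S :: ('a, 'a) module) (M :: ('a, ('a \<times> 'a) set) module).
      assoc_algebra R S \<and> left_module S M \<and> local_ring (module_End S M) \<longrightarrow>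
      (\<exists>!A. minimal_prime R A \<and> Supp R (restrict_scalars S M) \<subseteq> V R A)"
    and P: "P \<in> Spec R"
  interpret ring_localization R P
    using assms P by (intro ring_localization.intro) (simp_all add: Spec_def)
  \<comment> \<open>The hypothesis is applied to \<open>S = R\<close> and to the localization of
    \<open>R\<close> at \<open>P\<close>, whose fractions are sets of pairs over
    \<open>'a\<close>.\<close>
  have "\<exists>!A. minimal_prime R A \<and> Supp R (restrict_scalars (regular_module R) L) \<subseteq> V R A"
    using * assoc_algebra_regular lmod.left_module_axioms local_ring_End_localization by blast
  then obtain A where A: "minimal_prime R A" "Supp R (restrict_scalars (regular_module R) L) \<subseteq> V R A"
    by blast
  \<comment> \<open>Every prime below \<open>P\<close> is in the support and so contains
    \<open>A\<close>; a minimal prime below \<open>P\<close> must then equal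
    \<open>A\<close>.\<close>
  have sub: "A \<subseteq> B" if "B \<in> Spec R" "B \<subseteq> P" for B
    using mem_Supp_localization[OF that] A(2) by (auto simp: V_def)
  show "\<exists>!A. minimal_prime R A \<and> A \<subseteq> P"
  proof (rule ex1I)
    show "minimal_prime R A \<and> A \<subseteq> P"
      using A(1) sub[OF P] by blast
    show "B = A" if "minimal_prime R B \<and> B \<subseteq> P" for B
      using that A(1) sub[of B] unfolding minimal_prime_def by blast
  qed
\<comment> \<open>The two remaining goals are instances of one lemma, at the fixed types and at
  arbitrary ones.\<close>
qed ((elim conjE, rule module_local_End_minimal_prime; assumption)+)

end
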